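(* Let $\lambda\in\{2,3\}$ and let $k,d$ be integers with $k-\lambda\ge 2$ and $2(\lambda-1)\le d\le 2(k-2)$. Then $$m(k,d,\lambda)<d+2(k-\lambda).$$
   Context: For integers $k,d,\lambda\ge 1$ with $d\ge\lambda$, and a finite set $X\subset\mathbb{R}^d$, a Kneser transversal of $X$ is a $(d-\lambda)$-plane (affine subspace of dimension $d-\lambda$) that intersects the convex hull of every $k$-element subset of $X$. The number $m(k,d,\lambda)$ is the maximum positive integer $n$ such that every set of $n$ points (not necessarily in general position) in $\mathbb{R}^d$ admits a Kneser transversal. *)

theory Defs
  imports "HOL-Analysis.Analysis"
begin

text \<open>The letter \<open>l\<close> stands for the paper's parameter lambda, and the ambient space
  \<open>\<real>\<^sup>d\<close> is \<open>real ^ 'n\<close> with \<open>d = CARD('n)\<close>. The dimension \<open>d - l\<close> is formed in the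
  integers; for \<open>l \<le> d\<close> it is nonnegative, so that \<open>L\<close> is nonempty.\<close>

definition kneser_transversal :: "nat \<Rightarrow> nat \<Rightarrow> (real ^ 'n::finite) set \<Rightarrow> (real ^ 'n) set \<Rightarrow> bool" where
  "kneser_transversal k l X L \<longleftrightarrow>
     affine L \<and> aff_dim L = int CARD('n) - int l \<and>
     (\<forall>Y. Y \<subseteq> X \<and> card Y = k \<longrightarrow> L \<inter> convex hull Y \<noteq> {})"

text \<open>The number \<open>m(k,d,l)\<close> with \<open>d = CARD('n)\<close>; the dimension is passed as a type argument.
  \<open>Max\<close> is unspecified on empty and on infinite sets, so a bound on \<open>kneser_m\<close> can only be derived
  together with the existence of the maximum.\<close>

definition kneser_m :: "nat \<Rightarrow> 'n::finite itself \<Rightarrow> nat \<Rightarrow> nat" where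
  "kneser_m k (_ :: 'n itself) l =
     Max {n. n \<ge> 1 \<and>
             (\<forall>X :: (real ^ 'n) set. finite X \<and> card X = n \<longrightarrow> (\<exists>L. kneser_transversal k l X L))}"

end

theory Submission
  imports Defs
begin

text \<open>The point set is taken on the moment curve, with parameter set \<open>T\<close>. If \<open>L\<close> is a transversal,
  then the affine functionals vanishing on \<open>L\<close> restrict on the curve to an \<open>l\<close>-dimensional space \<open>V\<close>
  of polynomials of degree at most \<open>d\<close>, and none of them is positive at \<open>k\<close> points of \<open>T\<close>. If
  \<open>v \<in> V\<close> vanishes at a point \<open>s \<in> T\<close> that is not a common zero of \<open>V\<close>, then perturbing \<open>v\<close> makes
  \<open>s\<close> positive without losing positive points, so the subspace \<open>{v \<in> V. v(s) = 0}\<close> obeys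
  the same kind of bound with \<open>k\<close> and \<open>l\<close> both lowered by one, which allows an induction on \<open>l\<close>.

  The outcome is that \<open>V\<close> has \<open>d - l + 1\<close> common zeros in \<open>T\<close>, and that they separate the remaining
  \<open>2 k - l - 1\<close> points of \<open>T\<close>; this forces \<open>d > 2 (k - 2)\<close>. The only competing configuration, for
  \<open>l = 2\<close>, pairs off the remaining points so that the quadratics \<open>(x - a)(x - b)\<close> belonging to the
  pairs span a pencil. It is excluded by choosing \<open>T\<close> so that no three such quadratics with six
  distinct roots in \<open>T\<close> are linearly dependent.\<close>

section \<open>Point sets with no three pairs in a common involution\<close>

text \<open>Up to sign, the determinant of the coefficients of the quadratics \<open>(x - a\<^sub>i)(x - b\<^sub>i)\<close>. It
  vanishes iff the three pairs belong to a common involution of the projective line.\<close>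

definition pencil_det :: "real \<Rightarrow> real \<Rightarrow> real \<Rightarrow> real \<Rightarrow> real \<Rightarrow> real \<Rightarrow> real" where
  "pencil_det a1 b1 a2 b2 a3 b3 =
     (a1 + b1 - (a3 + b3)) * (a2 * b2 - a3 * b3) - (a2 + b2 - (a3 + b3)) * (a1 * b1 - a3 * b3)"

definition involution_free :: "real set \<Rightarrow> bool" where
  "involution_free T \<longleftrightarrow>
     (\<forall>a1 b1 a2 b2 a3 b3. {a1, b1, a2, b2, a3, b3} \<subseteq> T \<longrightarrow> distinct [a1, b1, a2, b2, a3, b3] \<longrightarrow>
        pencil_det a1 b1 a2 b2 a3 b3 \<noteq> 0)"

lemma involution_free_subset: "involution_free T \<Longrightarrow> S \<subseteq> T \<Longrightarrow> involution_free S"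
  unfolding involution_free_def by (meson order_trans)

text \<open>The determinant is affine in \<open>t\<close>, and it does not vanish at \<open>t = a1\<close>.\<close>

lemma finite_pencil_det_zeros:
  assumes "distinct [a1, b1, a2, b2, a3]"
  shows "finite {t. pencil_det a1 b1 a2 b2 a3 t = 0}"
proof -
  define q where "q = [:pencil_det a1 b1 a2 b2 a3 0,
    pencil_det a1 b1 a2 b2 a3 1 - pencil_det a1 b1 a2 b2 a3 0:]"
  have q: "pencil_det a1 b1 a2 b2 a3 t = poly q t" for t
    unfolding q_def pencil_det_def by (simp add: algebra_simps)
  have "pencil_det a1 b1 a2 b2 a3 a1 = (b1 - a3) * ((a1 - a2) * (a1 - b2))"
    unfolding pencil_det_def by (simp add: algebra_simps)
  then have "q \<noteq> 0" using assms q[of a1] by auto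
  then show ?thesis unfolding q by (rule poly_roots_finite)
qed

text \<open>The determinant is symmetric within each pair and changes sign when two pairs are
  exchanged. Hence any of the six entries can be moved to the last slot, and a newly added point
  needs to be checked only there.\<close>

lemma pencil_det_move_last:
  "pencil_det a1 b1 a2 b2 a3 b3 = pencil_det a1 b1 a2 b2 b3 a3"
  "pencil_det a1 b1 a2 b2 a3 b3 = - pencil_det a1 b1 a3 b3 a2 b2"
  "pencil_det a1 b1 a2 b2 a3 b3 = - pencil_det a1 b1 a3 b3 b2 a2"
  "pencil_det a1 b1 a2 b2 a3 b3 = - pencil_det a3 b3 a2 b2 a1 b1"
  "pencil_det a1 b1 a2 b2 a3 b3 = - pencil_det a3 b3 a2 b2 b1 a1"
  unfolding pencil_det_def by (simp_all add: algebra_simps)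

lemma involution_free_insert:
  assumes T: "involution_free T"
    and t: "\<And>a1 b1 a2 b2 a3. {a1, b1, a2, b2, a3} \<subseteq> T \<Longrightarrow> distinct [a1, b1, a2, b2, a3] \<Longrightarrow>
      pencil_det a1 b1 a2 b2 a3 t \<noteq> 0"
  shows "involution_free (insert t T)"
  unfolding involution_free_def
proof (intro allI impI)
  fix a1 b1 a2 b2 a3 b3
  assume sub: "{a1, b1, a2, b2, a3, b3} \<subseteq> insert t T"
    and dist: "distinct [a1, b1, a2, b2, a3, b3]"
  consider "t \<notin> {a1, b1, a2, b2, a3, b3}" | "t = a1" | "t = b1" | "t = a2" | "t = b2"
    | "t = a3" | "t = b3"
    by blast
  then show "pencil_det a1 b1 a2 b2 a3 b3 \<noteq> 0"
  proof cases
    case 1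
    then show ?thesis using T sub dist unfolding involution_free_def by blast
  next
    case 2
    then show ?thesis
      using t[of a3 b3 a2 b2 b1] sub dist pencil_det_move_last(5)[of a1 b1 a2 b2 a3 b3] by auto
  next
    case 3
    then show ?thesis
      using t[of a3 b3 a2 b2 a1] sub dist pencil_det_move_last(4)[of a1 b1 a2 b2 a3 b3] by auto
  next
    case 4
    then show ?thesis
      using t[of a1 b1 a3 b3 b2] sub dist pencil_det_move_last(3)[of a1 b1 a2 b2 a3 b3] by auto
  next
    case 5
    then show ?thesis
      using t[of a1 b1 a3 b3 a2] sub dist pencil_det_move_last(2)[of a1 b1 a2 b2 a3 b3] by auto
  next
    case 6
    then show ?thesis
      using t[of a1 b1 a2 b2 b3] sub dist pencil_det_move_last(1)[of a1 b1 a2 b2 a3 b3] by auto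
  next
    case 7
    then show ?thesis
      using t[of a1 b1 a2 b2 a3] sub dist by auto
  qed
qed

text \<open>Points are added one at a time. Each choice of five old points forbids only finitely
  many values for the new one, and the old points admit finitely many such choices.\<close>

lemma involution_free_exists:
  "\<exists>T. finite T \<and> card T = n \<and> involution_free T"
proof (induction n)
  case 0
  then show ?case by (auto simp: involution_free_def)
next
  case (Suc n)
  then obtain T where T: "finite T" "card T = n" "involution_free T" by blast
  define I where "I = {xs. set xs \<subseteq> T \<and> length xs = 5 \<and> distinct xs}"
  define B where "B = (\<Union>xs\<in>I. {t. pencil_det (xs!0) (xs!1) (xs!2) (xs!3) (xs!4) t = 0})"
  have "finite I"
    unfolding I_def by (rule finite_subset[OF _ finite_lists_length_eq[OF T(1), of 5]]) auto
  moreover have "finite {t. pencil_det (xs!0) (xs!1) (xs!2) (xs!3) (xs!4) t = 0}" if "xs \<in> I" for xs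
  proof (rule finite_pencil_det_zeros)
    show "distinct [xs!0, xs!1, xs!2, xs!3, xs!4]"
      using that unfolding I_def by (auto simp: nth_eq_iff_index_eq)
  qed
  ultimately have "finite B" unfolding B_def by blast
  then obtain t where t: "t \<notin> T \<union> B"
    using ex_new_if_finite[OF infinite_UNIV_char_0, of "T \<union> B"] T(1) by blast
  have "involution_free (insert t T)"
  proof (rule involution_free_insert[OF T(3)])
    fix a1 b1 a2 b2 a3
    assume "{a1, b1, a2, b2, a3} \<subseteq> T" "distinct [a1, b1, a2, b2, a3]"
    then have "[a1, b1, a2, b2, a3] \<in> I" unfolding I_def by simp
    with t show "pencil_det a1 b1 a2 b2 a3 t \<noteq> 0" unfolding B_def by fastforce
  qed
  then show ?case using T t by (intro exI[of _ "insert t T"]) auto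
qed

text \<open>Comparing coefficients shows that both rows of the 2 by 2 determinant
  \<open>pencil_det\<close>, multiplied by \<open>c\<close>, are multiples of the single vector
  formed by the differences of the sums and of the products of the first two pairs.\<close>

lemma pencil_det_eq_0:
  assumes "c \<noteq> 0"
    and eq: "smult c ([:- a3, 1:] * [:- b3, 1:]) =
      smult x ([:- a1, 1:] * [:- b1, 1:]) + smult y ([:- a2, 1:] * [:- b2, 1:])"
  shows "pencil_det a1 b1 a2 b2 a3 b3 = 0"
proof -
  have c: "c = x + y"
    using arg_cong[OF eq, of "\<lambda>q. coeff q 2"] by (simp add: numeral_2_eq_2)
  have s: "c * (a3 + b3) = x * (a1 + b1) + y * (a2 + b2)"
    using arg_cong[OF eq, of "\<lambda>q. coeff q 1"] by (simp add: algebra_simps)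
  have p: "c * (a3 * b3) = x * (a1 * b1) + y * (a2 * b2)"
    using arg_cong[OF eq, of "\<lambda>q. coeff q 0"] by (simp add: mult_ac)
  have "c * (a1 + b1 - (a3 + b3)) = y * (a1 + b1 - (a2 + b2))"
    "c * (a1 * b1 - a3 * b3) = y * (a1 * b1 - a2 * b2)"
    "c * (a2 + b2 - (a3 + b3)) = - x * (a1 + b1 - (a2 + b2))"
    "c * (a2 * b2 - a3 * b3) = - x * (a1 * b1 - a2 * b2)"
    unfolding right_diff_distrib s p unfolding c by (simp_all add: algebra_simps)
  then have "c * c * pencil_det a1 b1 a2 b2 a3 b3 = 0"
    unfolding pencil_det_def by algebra
  with assms(1) show ?thesis by simp
qed

section \<open>Separated points, small perturbations, polynomials with many roots\<close>

lemma card_le_Suc_card_if_separated: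
  fixes A S :: "'a::linorder set"
  assumes "finite S" "finite A"
    and "\<And>x y. x \<in> S \<Longrightarrow> y \<in> S \<Longrightarrow> x < y \<Longrightarrow> \<exists>a\<in>A. x < a \<and> a < y"
  shows "card S \<le> Suc (card A)"
  using assms
proof (induction S arbitrary: A rule: finite_linorder_max_induct)
  case empty
  then show ?case by simp
next
  case (insert b S)
  show ?case
  proof (cases "S = {}")
    case False
    define m where "m = Max S"
    have m: "m \<in> S" "\<And>x. x \<in> S \<Longrightarrow> x \<le> m"
      using False insert.hyps unfolding m_def by auto
    obtain a where a: "a \<in> A" "m < a" "a < b"
      using insert.prems(2)[of m b] insert.hyps m by blast
    \<comment> \<open>The separator \<open>a\<close> lies above every element of \<open>S\<close>,
      so the pairs within \<open>S\<close> never need it and it can be removed along with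
      \<open>b\<close>.\<close>
    have "card S \<le> Suc (card (A - {a}))"
    proof (rule insert.IH)
      fix x y assume xy: "x \<in> S" "y \<in> S" "x < y"
      then obtain c where "c \<in> A" "x < c" "c < y" using insert.prems(2)[of x y] by blast
      moreover have "y \<le> m" using m xy by blast
      ultimately show "\<exists>c\<in>A - {a}. x < c \<and> c < y" using a by (intro bexI[of _ c]) auto
    qed (use insert.prems in auto)
    moreover have "card A = Suc (card (A - {a}))"
      using a insert.prems(1) by (metis card_Suc_Diff1)
    moreover have "card (insert b S) = Suc (card S)"
      using insert.hyps by auto
    ultimately show ?thesis by linarith
  qed simp
qed

text \<open>Finitely many strict inequalities all survive for small positive
  \<open>e\<close>.\<close>

lemma small_perturbation:
  fixes f g :: "'a \<Rightarrow> real"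
  assumes "finite T"
  shows "\<exists>e>0. \<forall>t\<in>T. f t > 0 \<longrightarrow> f t + e * g t > 0"
proof -
  have "\<forall>\<^sub>F e in at_right 0. f t > 0 \<longrightarrow> f t + e * g t > 0" for t
  proof (cases "f t > 0")
    case True
    have "((\<lambda>e. f t + e * g t) \<longlongrightarrow> f t + 0 * g t) (at_right 0)"
      by (intro tendsto_intros)
    then show ?thesis
      using True order_tendstoD(1)[of "\<lambda>e. f t + e * g t" "f t" "at_right 0" 0] by simp
  qed simp
  then have "\<forall>\<^sub>F e in at_right 0. \<forall>t\<in>T. f t > 0 \<longrightarrow> f t + e * g t > 0"
    using assms by (simp add: eventually_ball_finite)
  then have "\<forall>\<^sub>F e in at_right 0. e > 0 \<and> (\<forall>t\<in>T. f t > 0 \<longrightarrow> f t + e * g t > 0)"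
    using eventually_at_right_less by (rule eventually_conj[rotated])
  then show ?thesis
    using eventually_happens'[OF trivial_limit_at_right_real] by blast
qed

lemma poly_eq_smult_prod_roots:
  fixes p :: "real poly"
  assumes "finite Z" "degree p \<le> card Z" "\<And>z. z \<in> Z \<Longrightarrow> poly p z = 0"
  shows "\<exists>c. p = smult c (\<Prod>z\<in>Z. [:- z, 1:])"
  using assms
proof (induction Z arbitrary: p rule: finite_induct)
  case empty
  then show ?case by (auto elim: degree_eq_zeroE)
next
  case (insert z Z)
  then obtain q where q: "p = [:- z, 1:] * q"
    by (metis insertI1 poly_eq_0_iff_dvd dvdE)
  have "\<exists>c. q = smult c (\<Prod>z\<in>Z. [:- z, 1:])"
  proof (rule insert.IH)
    show "degree q \<le> card Z"
    proof (cases "q = 0")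
      case False
      then have "degree p = Suc (degree q)" unfolding q by (subst degree_mult_eq) auto
      then show ?thesis using insert by simp
    qed simp
    show "poly q x = 0" if "x \<in> Z" for x
      using insert.prems(2)[of x] that insert.hyps by (auto simp: q)
  qed
  then obtain c where "q = smult c (\<Prod>z\<in>Z. [:- z, 1:])" by blast
  then have "p = smult c (\<Prod>z\<in>insert z Z. [:- z, 1:])"
    unfolding prod.insert[OF insert.hyps] using q by (simp only: mult_smult_right)
  then show ?case by blast
qed


section \<open>Spaces of polynomials with few positive points\<close>

text \<open>\<open>P v\<close> models the affine functional with normal vector \<open>v\<close>,
  restricted to the moment curve. Since \<open>P\<close> is linear and injective, dimensions of
  polynomial spaces can be counted in the euclidean space \<open>'a\<close>.\<close>

locale poly_coordinates =
  fixes P :: "'a::euclidean_space \<Rightarrow> real poly" and d :: nat and T :: "real set"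
  assumes P_add: "P (u + v) = P u + P v"
    and P_scale: "P (c *\<^sub>R v) = smult c (P v)"
    and P_eq_0: "P v = 0 \<Longrightarrow> v = 0"
    and degree_P: "degree (P v) \<le> d"
    and finite_T: "finite T"
begin

definition pos :: "'a \<Rightarrow> real set" where "pos v = {t \<in> T. poly (P v) t > 0}"

definition zer :: "'a \<Rightarrow> real set" where "zer v = {t \<in> T. poly (P v) t = 0}"

definition common_zer :: "'a set \<Rightarrow> real set" where "common_zer V = {t \<in> T. \<forall>v\<in>V. poly (P v) t = 0}"

definition through :: "'a set \<Rightarrow> real \<Rightarrow> 'a set" where "through V s = {v \<in> V. poly (P v) s = 0}"

lemma P_minus: "P (- v) = - P v"
  using P_scale[of "-1" v] by simp

lemma P_diff: "P (u - v) = P u - P v"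
  using P_add[of u "- v"] by (simp add: P_minus)

lemma P_0: "P 0 = 0"
  using P_scale[of 0 0] by simp

lemma finite_pos [simp]: "finite (pos v)" and finite_zer [simp]: "finite (zer v)"
  and finite_common_zer [simp]: "finite (common_zer V)"
  unfolding pos_def zer_def common_zer_def using finite_T by auto

lemma zer_scale: "c \<noteq> 0 \<Longrightarrow> zer (c *\<^sub>R v) = zer v"
  unfolding zer_def by (simp add: P_scale)

lemma card_zer_le:
  assumes "v \<noteq> 0"
  shows "card (zer v) \<le> d"
proof -
  have "P v \<noteq> 0" using assms P_eq_0 by blast
  then have "card {t. poly (P v) t = 0} \<le> degree (P v)" by (rule card_poly_roots_bound)
  moreover have "card (zer v) \<le> card {t. poly (P v) t = 0}"
    unfolding zer_def using \<open>P v \<noteq> 0\<close> by (intro card_mono poly_roots_finite) auto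
  ultimately show ?thesis using degree_P[of v] by linarith
qed

lemma card_pos_neg_zer: "card (pos v) + card (pos (- v)) + card (zer v) = card T"
proof -
  have "T = pos v \<union> pos (- v) \<union> zer v" unfolding pos_def zer_def by (auto simp: P_minus)
  moreover have "pos v \<inter> pos (- v) = {}" "(pos v \<union> pos (- v)) \<inter> zer v = {}"
    unfolding pos_def zer_def by (auto simp: P_minus)
  ultimately show ?thesis by (metis card_Un_disjoint finite_Un finite_pos finite_zer)
qed

lemma subspace_through:
  assumes "subspace V"
  shows "subspace (through V s)"
  using assms unfolding through_def subspace_def by (auto simp: P_add P_scale P_0)

lemma dim_through:
  assumes V: "subspace V" and h: "h \<in> V" "poly (P h) s \<noteq> 0"
  shows "dim V = Suc (dim (through V s))"
proof -
  have sub: "subspace (through V s)" using V by (rule subspace_through)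
  have "V \<subseteq> span (insert h (through V s))"
  proof
    fix v assume v: "v \<in> V"
    define c where "c = poly (P v) s / poly (P h) s"
    have "v - c *\<^sub>R h \<in> through V s"
      unfolding through_def c_def using v h V
      by (auto simp: P_diff P_scale intro!: subspace_diff subspace_scale)
    then show "v \<in> span (insert h (through V s))"
      unfolding span_insert span_eq_iff[THEN iffD2, OF sub] by blast
  qed
  moreover have "insert h (through V s) \<subseteq> V" using h unfolding through_def by blast
  ultimately have "dim V = dim (insert h (through V s))"
    by (metis antisym dim_span dim_subset)
  moreover have "h \<notin> span (through V s)"
    unfolding span_eq_iff[THEN iffD2, OF sub] using h by (simp add: through_def)
  ultimately show ?thesis by (simp add: dim_insert)
qed

lemma dim_through_point:
  assumes "subspace V" "s \<in> T - common_zer V"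
  shows "dim V = Suc (dim (through V s))"
  using assms dim_through unfolding common_zer_def by blast

lemma exists_nonzero:
  fixes V :: "'a set"
  assumes "0 < dim V"
  shows "\<exists>v\<in>V. v \<noteq> 0"
proof (rule ccontr)
  assume "\<not> ?thesis"
  then have "V \<subseteq> span {}" by auto
  then have "dim V \<le> card ({} :: 'a set)" by (rule dim_le_card) simp
  with assms show False by (simp only: card.empty)
qed

text \<open>For small \<open>e > 0\<close>, the element \<open>v + e *\<^sub>R h\<close> keeps the
  positive points of \<open>v\<close> and gains those zeros of \<open>v\<close> at which
  \<open>h\<close> is positive.\<close>

lemma card_pos_perturb:
  assumes V: "subspace V" and K: "\<And>v. v \<in> V \<Longrightarrow> card (pos v) \<le> K"
    and "v \<in> V" "h \<in> V"
  shows "card (pos v) + card (zer v \<inter> pos h) \<le> K"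
proof -
  obtain e where e: "e > 0" "\<forall>t\<in>T. poly (P v) t > 0 \<longrightarrow> poly (P v) t + e * poly (P h) t > 0"
    using small_perturbation[OF finite_T] by metis
  have "pos v \<union> (zer v \<inter> pos h) \<subseteq> pos (v + e *\<^sub>R h)"
    using e unfolding pos_def zer_def by (auto simp: P_add P_scale)
  then have "card (pos v \<union> (zer v \<inter> pos h)) \<le> card (pos (v + e *\<^sub>R h))"
    by (intro card_mono) auto
  also have "\<dots> \<le> K"
    using assms by (intro K) (auto intro: subspace_add subspace_scale)
  also have "card (pos v \<union> (zer v \<inter> pos h)) = card (pos v) + card (zer v \<inter> pos h)"
    by (rule card_Un_disjoint) (simp_all, auto simp: pos_def zer_def)
  finally show ?thesis .
qed

text \<open>This is the step that lowers the bound: some \<open>h\<close> in \<open>V\<close>, after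
  a change of sign if necessary, is positive at the zero \<open>s\<close> of \<open>v\<close>, so
  perturbing \<open>v\<close> gains at least one positive point.\<close>

lemma card_pos_through:
  assumes V: "subspace V" and K: "\<And>v. v \<in> V \<Longrightarrow> card (pos v) \<le> Suc K"
    and s: "s \<in> T - common_zer V" and v: "v \<in> through V s"
  shows "card (pos v) \<le> K"
proof -
  obtain h0 where h0: "h0 \<in> V" "poly (P h0) s \<noteq> 0" using s unfolding common_zer_def by blast
  define h where "h = (if poly (P h0) s > 0 then h0 else - h0)"
  have h: "h \<in> V" "poly (P h) s > 0"
    unfolding h_def using h0 V by (auto simp: P_minus subspace_neg)
  then have "s \<in> zer v \<inter> pos h" using s v unfolding zer_def pos_def through_def by auto
  then have "card (zer v \<inter> pos h) > 0" by (auto simp: card_gt_0_iff)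
  then show ?thesis
    using card_pos_perturb[OF V K _ h(1), of v] v unfolding through_def by simp
qed

text \<open>At most \<open>d\<close> zeros and at most \<open>r\<close> points of either sign must
  add up to \<open>d + 2 * r\<close>, so all three bounds are attained.\<close>

lemma balanced:
  assumes "v \<noteq> 0" "card T = d + 2 * r" "card (pos v) \<le> r" "card (pos (- v)) \<le> r"
  shows "card (zer v) = d" "card (pos v) = r" "card (pos (- v)) = r"
  using card_zer_le[OF assms(1)] card_pos_neg_zer[of v] assms by linarith+

lemma P_eq_smult_prod:
  assumes "v \<noteq> 0" "card (zer v) = d"
  shows "\<exists>c. c \<noteq> 0 \<and> P v = smult c (\<Prod>z\<in>zer v. [:- z, 1:])"
proof -
  have "\<And>z. z \<in> zer v \<Longrightarrow> poly (P v) z = 0" unfolding zer_def by blast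
  then obtain c where c: "P v = smult c (\<Prod>z\<in>zer v. [:- z, 1:])"
    using poly_eq_smult_prod_roots[of "zer v" "P v"] assms(2) degree_P[of v] finite_zer by metis
  moreover have "c \<noteq> 0" using c assms(1) P_eq_0 by (metis smult_0_left)
  ultimately show ?thesis by blast
qed

text \<open>Since \<open>through V s\<close> is a line, \<open>u\<close> and \<open>v\<close> are
  proportional.\<close>

lemma zer_eq_of_common_zero:
  assumes V: "subspace V" "dim V = 2" and s: "s \<in> T - common_zer V"
    and u: "u \<in> V" "u \<noteq> 0" "s \<in> zer u" and v: "v \<in> V" "v \<noteq> 0" "s \<in> zer v"
  shows "zer u = zer v"
proof -
  have d1: "dim (through V s) = 1" using dim_through_point[OF V(1) s] V(2) by simp
  have uv: "u \<in> through V s" "v \<in> through V s"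
    using u v unfolding through_def zer_def by auto
  have "u \<in> span {v}"
  proof (rule ccontr)
    assume n: "u \<notin> span {v}"
    then have "independent {u, v}" using v(2) by (simp add: independent_insert)
    then have "card {u, v} \<le> dim (through V s)"
      using uv by (intro independent_card_le_dim) auto
    moreover have "u \<noteq> v" using n span_base by blast
    ultimately show False using d1 by simp
  qed
  then obtain c where "u = c *\<^sub>R v" by (auto simp: span_singleton)
  then show ?thesis using u(2) zer_scale[of c v] by force
qed


section \<open>Spaces of dimension two\<close>

text \<open>Every \<open>s\<close> outside the set \<open>A\<close> of common zeros has an
  \<open>f s\<close>, unique up to scaling, that vanishes there. The sets
  \<open>zer (f s) - A\<close> partition the points outside \<open>A\<close> into classes of the
  same size \<open>d - card A\<close>, which is 1 or 2. Size 2 would put three pairs into one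
  pencil; size 1 gives the count, and separation follows by comparing neighbouring points.\<close>

lemma dim_2_structure:
  assumes V: "subspace V" "dim V = 2"
    and T: "card T = d + 2 * r" "r \<ge> 2" "involution_free T"
    and K: "\<And>v. v \<in> V \<Longrightarrow> card (pos v) \<le> Suc r"
  shows "Suc (card (common_zer V)) = d"
    and "\<And>x y. x \<in> T - common_zer V \<Longrightarrow> y \<in> T - common_zer V \<Longrightarrow> x < y \<Longrightarrow>
      \<exists>a\<in>common_zer V. x < a \<and> a < y"
proof -
  define A where "A = common_zer V"
  define S where "S = T - A"
  have finS: "finite S" unfolding S_def using finite_T by simp
  have A_sub: "A \<subseteq> T" "finite A" unfolding A_def common_zer_def using finite_T by auto
  have "\<exists>v. v \<in> V \<and> v \<noteq> 0 \<and> poly (P v) s = 0" if "s \<in> S" for s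
  proof -
    have "dim (through V s) = 1" using dim_through_point[OF V(1)] that V(2) by (simp add: S_def A_def)
    then show ?thesis using exists_nonzero[of "through V s"] unfolding through_def by auto
  qed
  then obtain f where f: "\<And>s. s \<in> S \<Longrightarrow> f s \<in> V \<and> f s \<noteq> 0 \<and> poly (P (f s)) s = 0" by metis
  have s_zer: "s \<in> zer (f s)" if "s \<in> S" for s
    using f[OF that] that unfolding zer_def S_def by blast
  have A_zer: "A \<subseteq> zer (f s)" if "s \<in> S" for s
    using f[OF that] unfolding A_def common_zer_def zer_def by blast
  have zer_sub: "zer (f s) \<subseteq> A \<union> S" for s unfolding S_def zer_def by blast
  \<comment> \<open>Both \<open>f s\<close> and \<open>- f s\<close> lie in
    \<open>through V s\<close>, so the lowered bound \<open>r\<close> holds for both signs and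
    \<open>balanced\<close> applies.\<close>
  have bal: "card (zer (f s)) = d" "card (pos (f s)) = r" "card (pos (- f s)) = r" if s: "s \<in> S" for s
  proof -
    have sT: "s \<in> T - common_zer V" using s unfolding S_def A_def .
    have "f s \<in> through V s" "- f s \<in> through V s"
      using f[OF s] V(1) unfolding through_def by (auto simp: P_minus subspace_neg)
    then have "card (pos (f s)) \<le> r" "card (pos (- f s)) \<le> r"
      using card_pos_through[OF V(1) K sT] by blast+
    then show "card (zer (f s)) = d" "card (pos (f s)) = r" "card (pos (- f s)) = r"
      using balanced[OF _ T(1)] f[OF s] by blast+
  qed
  have zer_eq: "zer (f s) = zer (f t)" if "s \<in> S" "t \<in> S" "u \<in> S" "u \<in> zer (f s)" "u \<in> zer (f t)" for s t u
    using zer_eq_of_common_zero[OF V, of u "f s" "f t"] f that unfolding S_def A_def by blast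
  \<comment> \<open>A functional \<open>h\<close> independent of \<open>f s\<close> is nonzero on \<open>zer (f s) - A\<close>; perturbing \<open>f s\<close> by \<open>h\<close> and
    by \<open>- h\<close> turns all these points positive, one perturbation or the other, and each gains at most one.\<close>
  have class_le: "card (zer (f s) - A) \<le> 2" if s: "s \<in> S" for s
  proof -
    obtain h where h: "h \<in> V" "poly (P h) s \<noteq> 0"
      using s unfolding S_def A_def common_zer_def by blast
    have h_nz: "poly (P h) t \<noteq> 0" if t: "t \<in> zer (f s) - A" for t
    proof
      assume "poly (P h) t = 0"
      then have "t \<in> zer h" using t unfolding zer_def by blast
      moreover have "h \<noteq> 0" using h(2) by (auto simp: P_0)
      moreover have "t \<in> T - common_zer V" using t unfolding A_def zer_def by blast
      ultimately have "zer (f s) = zer h"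
        using zer_eq_of_common_zero[OF V, of t "f s" h] f[OF s] h(1) t by blast
      then show False using s_zer[OF s] h(2) unfolding zer_def by blast
    qed
    have mh: "- h \<in> V" using h(1) V(1) by (simp add: subspace_neg)
    have "zer (f s) - A \<subseteq> (zer (f s) \<inter> pos h) \<union> (zer (f s) \<inter> pos (- h))"
    proof
      fix t assume t: "t \<in> zer (f s) - A"
      then have "t \<in> T" "t \<in> zer (f s)" unfolding zer_def by auto
      then show "t \<in> (zer (f s) \<inter> pos h) \<union> (zer (f s) \<inter> pos (- h))"
        using h_nz[OF t] unfolding pos_def by (auto simp: P_minus)
    qed
    then have "card (zer (f s) - A) \<le> card ((zer (f s) \<inter> pos h) \<union> (zer (f s) \<inter> pos (- h)))"
      by (intro card_mono) auto
    also have "\<dots> \<le> card (zer (f s) \<inter> pos h) + card (zer (f s) \<inter> pos (- h))"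
      by (rule card_Un_le)
    also have "\<dots> \<le> 1 + 1"
      using card_pos_perturb[OF V(1) K _ h(1), of "f s"] card_pos_perturb[OF V(1) K _ mh, of "f s"]
        bal(2)[OF s] f[OF s] by simp
    finally show ?thesis by simp
  qed
  have card_class: "card (zer (f s) - A) = d - card A" if "s \<in> S" for s
    using bal(1)[OF that] A_zer[OF that] A_sub by (simp add: card_Diff_subset)
  have card_S: "card S + card A = d + 2 * r"
    using T(1) A_sub finite_T unfolding S_def
    by (metis card_Diff_subset card_mono le_add_diff_inverse2)
  have "S \<noteq> {}"
  proof
    assume "S = {}"
    then have "T = A" using A_sub unfolding S_def by blast
    moreover obtain v where "v \<in> V" "v \<noteq> 0" using exists_nonzero[of V] V(2) by auto
    ultimately have "card T \<le> card (zer v)" unfolding A_def common_zer_def zer_def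
      using finite_T by (intro card_mono) auto
    then show False using card_zer_le[OF \<open>v \<noteq> 0\<close>] T by linarith
  qed
  then obtain s0 where s0: "s0 \<in> S" by blast
  have class_pos: "d - card A > 0" "card A \<le> d"
  proof -
    have "zer (f s0) - A \<noteq> {}" using s_zer[OF s0] s0 unfolding S_def by blast
    then have "card (zer (f s0) - A) > 0" by (simp add: card_gt_0_iff)
    then show "d - card A > 0" using card_class[OF s0] by simp
    show "card A \<le> d" using bal(1)[OF s0] A_zer[OF s0] by (metis card_mono finite_zer)
  qed
  have "d - card A \<noteq> 2"
  proof
    assume two: "d - card A = 2"
    have partner: "\<exists>t\<in>S. t \<noteq> s \<and> zer (f s) = insert s (insert t A)" if s: "s \<in> S" for s
    proof -
      have "card (zer (f s) - A) = 2" using card_class[OF s] two by simp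
      then obtain a b where ab: "zer (f s) - A = {a, b}" "a \<noteq> b" by (meson card_2_iff)
      have z: "zer (f s) = insert a (insert b A)" using ab A_zer[OF s] by blast
      have "a \<in> S" "b \<in> S" using ab zer_sub[of s] by blast+
      moreover have "s = a \<or> s = b" using z s_zer[OF s] s unfolding S_def by blast
      ultimately show ?thesis using z ab(2) by (auto simp: insert_commute)
    qed
    \<comment> \<open>Here \<open>card S = 2 * r + 2\<close>, so \<open>r \<ge> 2\<close> leaves
      room for three disjoint pairs.\<close>
    have S_big: "card S \<ge> 6" using card_S two class_pos T(2) by linarith
    obtain s1 where s1: "s1 \<in> S" using s0 by blast
    obtain t1 where t1: "t1 \<in> S" "t1 \<noteq> s1" "zer (f s1) = insert s1 (insert t1 A)"
      using partner[OF s1] by blast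
    have pick: "\<exists>s\<in>S. s \<notin> B" if "finite B" "card B < 6" for B
    proof (rule ccontr)
      assume "\<not> ?thesis"
      then have "card S \<le> card B" using that(1) by (intro card_mono) auto
      then show False using S_big that(2) by simp
    qed
    have "card {s1, t1} < 6" by (simp add: card_insert_if)
    then obtain s2 where s2: "s2 \<in> S" "s2 \<notin> {s1, t1}"
      using pick[of "{s1, t1}"] by blast
    obtain t2 where t2: "t2 \<in> S" "t2 \<noteq> s2" "zer (f s2) = insert s2 (insert t2 A)"
      using partner[OF s2(1)] by blast
    have "card {s1, t1, s2, t2} < 6" by (simp add: card_insert_if)
    then obtain s3 where s3: "s3 \<in> S" "s3 \<notin> {s1, t1, s2, t2}"
      using pick[of "{s1, t1, s2, t2}"] by blast
    obtain t3 where t3: "t3 \<in> S" "t3 \<noteq> s3" "zer (f s3) = insert s3 (insert t3 A)"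
      using partner[OF s3(1)] by blast
    have SA: "x \<notin> A" if "x \<in> S" for x using that unfolding S_def by blast
    have t2_new: "t2 \<notin> {s1, t1}"
    proof
      assume "t2 \<in> {s1, t1}"
      then have "zer (f s1) = zer (f s2)" using zer_eq[OF s1 s2(1) t2(1)] t1 t2 by blast
      then show False using s2 SA[OF s2(1)] t1(3) t2(3) by blast
    qed
    have t3_new: "t3 \<notin> {s1, t1, s2, t2}"
    proof
      assume "t3 \<in> {s1, t1, s2, t2}"
      then have "zer (f s1) = zer (f s3) \<or> zer (f s2) = zer (f s3)"
        using zer_eq[OF s1 s3(1) t3(1)] zer_eq[OF s2(1) s3(1) t3(1)] t1 t2 t3 by blast
      then show False using s3 SA[OF s3(1)] t1(3) t2(3) t3(3) by blast
    qed
    have dist: "distinct [s1, t1, s2, t2, s3, t3]"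
      using t1(2) s2(2) t2(2) t2_new s3(2) t3(2) t3_new by auto
    \<comment> \<open>The factor \<open>p\<close> is common to \<open>P (f s1)\<close>,
      \<open>P (f s2)\<close> and \<open>P (f s3)\<close>. Cancelling it turns a linear relation
      between them into one between three quadratics.\<close>
    define p where "p = (\<Prod>z\<in>A. [:- z, 1:])"
    have "p \<noteq> 0" unfolding p_def using A_sub by simp
    have fac: "\<exists>c. c \<noteq> 0 \<and> P (f s) = smult c (p * ([:- s, 1:] * [:- t, 1:]))"
      if "s \<in> S" "t \<in> S" "t \<noteq> s" "zer (f s) = insert s (insert t A)" for s t
    proof -
      have fresh: "finite A" "t \<notin> A" "finite (insert t A)" "s \<notin> insert t A"
        using that SA A_sub by auto
      have "(\<Prod>z\<in>zer (f s). [:- z, 1:]) = p * ([:- s, 1:] * [:- t, 1:])"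
        unfolding that(4) p_def prod.insert[OF fresh(3,4)] prod.insert[OF fresh(1,2)]
        by (simp only: mult_ac)
      then show ?thesis using P_eq_smult_prod[of "f s"] f[OF that(1)] bal(1)[OF that(1)] by metis
    qed
    obtain c1 where c1: "c1 \<noteq> 0" "P (f s1) = smult c1 (p * ([:- s1, 1:] * [:- t1, 1:]))"
      using fac[OF s1 t1] by blast
    obtain c2 where c2: "c2 \<noteq> 0" "P (f s2) = smult c2 (p * ([:- s2, 1:] * [:- t2, 1:]))"
      using fac[OF s2(1) t2] by blast
    obtain c3 where c3: "c3 \<noteq> 0" "P (f s3) = smult c3 (p * ([:- s3, 1:] * [:- t3, 1:]))"
      using fac[OF s3(1) t3] by blast
    have s2_1: "s2 \<notin> zer (f s1)" and s1_2: "s1 \<notin> zer (f s2)"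
      using t1 t2 s2 SA[OF s1] SA[OF s2(1)] t2_new by auto
    \<comment> \<open>Chosen so that \<open>w\<close> below vanishes at \<open>s1\<close> and \<open>s2\<close>, which forces \<open>w = 0\<close>.\<close>
    define x where "x = poly (P (f s3)) s2 / poly (P (f s1)) s2"
    define y where "y = poly (P (f s3)) s1 / poly (P (f s2)) s1"
    define w where "w = f s3 - x *\<^sub>R f s1 - y *\<^sub>R f s2"
    have "w \<in> V"
      unfolding w_def using f[OF s1] f[OF s2(1)] f[OF s3(1)] V(1)
      by (intro subspace_diff subspace_scale) auto
    have "poly (P (f s1)) s2 \<noteq> 0" "poly (P (f s2)) s1 \<noteq> 0"
      using s2_1 s1_2 s1 s2(1) unfolding zer_def S_def by auto
    then have "poly (P w) s1 = 0" "poly (P w) s2 = 0"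
      unfolding w_def using f[OF s1] f[OF s2(1)] by (auto simp: P_diff P_scale x_def y_def)
    then have "s1 \<in> zer w" "s2 \<in> zer w"
      using s1 s2(1) unfolding zer_def S_def by auto
    have "w = 0"
    proof (rule ccontr)
      assume "w \<noteq> 0"
      then have "zer w = zer (f s1)"
        using zer_eq_of_common_zero[OF V, of s1 w "f s1"] s1 f[OF s1] s_zer[OF s1] \<open>w \<in> V\<close>
          \<open>s1 \<in> zer w\<close> unfolding S_def A_def by blast
      then show False using \<open>s2 \<in> zer w\<close> s2_1 by blast
    qed
    then have "P (f s3 - x *\<^sub>R f s1 - y *\<^sub>R f s2) = 0" unfolding w_def by (simp add: P_0)
    then have "P (f s3) = smult x (P (f s1)) + smult y (P (f s2))"
      unfolding P_diff P_scale by (simp add: diff_diff_eq)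
    then have "p * smult c3 ([:- s3, 1:] * [:- t3, 1:]) =
        p * (smult (x * c1) ([:- s1, 1:] * [:- t1, 1:]) + smult (y * c2) ([:- s2, 1:] * [:- t2, 1:]))"
      unfolding c1(2) c2(2) c3(2)
      by (simp only: mult_smult_right smult_smult distrib_left)
    then have "smult c3 ([:- s3, 1:] * [:- t3, 1:]) =
        smult (x * c1) ([:- s1, 1:] * [:- t1, 1:]) + smult (y * c2) ([:- s2, 1:] * [:- t2, 1:])"
      using \<open>p \<noteq> 0\<close> by (simp only: mult_cancel_left simp_thms)
    then have "pencil_det s1 t1 s2 t2 s3 t3 = 0" by (rule pencil_det_eq_0[OF c3(1)])
    moreover have "{s1, t1, s2, t2, s3, t3} \<subseteq> T"
      using s1 t1 s2 t2 s3 t3 unfolding S_def by blast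
    ultimately show False using T(3) dist unfolding involution_free_def by blast
  qed
  then have dA: "Suc (card A) = d" using class_pos class_le[OF s0] card_class[OF s0] by linarith
  show "Suc (card (common_zer V)) = d" using dA unfolding A_def .
  show "\<exists>a\<in>common_zer V. x < a \<and> a < y"
    if x: "x \<in> T - common_zer V" and y: "y \<in> T - common_zer V" and xy: "x < y" for x y
  proof (rule ccontr)
    assume "\<not> ?thesis"
    then have no: "\<not> (x < a \<and> a < y)" if "a \<in> A" for a using that unfolding A_def by blast
    \<comment> \<open>For neighbours \<open>x, y'\<close> in \<open>S\<close> where \<open>p\<close> has the same sign, \<open>p (X - x)\<close> and \<open>p (X - y')\<close> have
      different numbers of positive points, although both numbers are \<open>r\<close>.\<close>
    define y' where "y' = Min {u \<in> S. x < u}"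
    have fin: "finite {u \<in> S. x < u}" using finS by simp
    have "y \<in> {u \<in> S. x < u}" using y xy unfolding S_def A_def by blast
    then have y': "y' \<in> S" "x < y'" "y' \<le> y" and least: "\<And>u. u \<in> S \<Longrightarrow> x < u \<Longrightarrow> y' \<le> u"
      unfolding y'_def using Min_in[OF fin] Min_le[OF fin] by blast+
    have xS: "x \<in> S" using x unfolding S_def A_def .
    \<comment> \<open>Between \<open>x\<close> and \<open>y'\<close>, points of \<open>S\<close> are
      excluded by the choice of \<open>y'\<close> and points of \<open>A\<close> by
      \<open>no\<close>.\<close>
    have out: "t \<le> x \<or> y' \<le> t" if "t \<in> T" for t
      using that no[of t] y' least[of t] unfolding S_def by force
    define p where "p = (\<Prod>z\<in>A. [:- z, 1:])"
    have p0: "poly p t = 0 \<longleftrightarrow> t \<in> A" for t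
      unfolding p_def poly_prod using A_sub(2) by auto
    have nz: "poly p x \<noteq> 0" "poly p y' \<noteq> 0" using xS y' p0 unfolding S_def by auto
    have same_sign: "poly p x * poly p y' > 0"
    proof (rule ccontr)
      assume "\<not> ?thesis"
      then have "poly p x * poly p y' < 0" using nz by (simp add: less_le)
      then obtain z where "x < z" "z < y'" "poly p z = 0" using poly_IVT[OF y'(2)] by blast
      then show False using p0 no y'(3) by force
    qed
    define Q where "Q s = {t \<in> T. poly p t * (t - s) > 0}" for s
    have finQ: "finite (Q s)" for s unfolding Q_def using finite_T by simp
    have card_Q: "card (Q s) = r" if s: "s \<in> S" for s
    proof -
      have "insert s A \<subseteq> zer (f s)" using s_zer[OF s] A_zer[OF s] by blast
      moreover have "card (insert s A) = card (zer (f s))"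
        using bal(1)[OF s] dA s A_sub unfolding S_def by simp
      ultimately have "zer (f s) = insert s A" by (metis card_subset_eq finite_zer)
      then have "(\<Prod>z\<in>zer (f s). [:- z, 1:]) = [:- s, 1:] * p"
        using s A_sub unfolding p_def S_def by simp
      then obtain c where c: "c \<noteq> 0" "P (f s) = smult c ([:- s, 1:] * p)"
        using P_eq_smult_prod[of "f s"] f[OF s] bal(1)[OF s] by metis
      have ev: "poly (P (f s)) t = c * (poly p t * (t - s))" for t
        unfolding c(2) by (simp add: algebra_simps)
      \<comment> \<open>The sign of \<open>c\<close> decides between \<open>f s\<close> and
        \<open>- f s\<close>, and both have exactly \<open>r\<close> positive points.\<close>
      have "Q s = pos (f s) \<or> Q s = pos (- f s)"
        unfolding Q_def pos_def P_minus poly_minus ev using c(1)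
        by (cases "c > 0") (auto simp: zero_less_mult_iff mult_less_0_iff)
      then show ?thesis using bal[OF s] by metis
    qed
    have same: "t \<in> Q x \<longleftrightarrow> t \<in> Q y'" if "t \<noteq> x" "t \<noteq> y'" for t
      using that out[of t] y'(2) unfolding Q_def by (auto simp: zero_less_mult_iff)
    have xT: "x \<in> T" "y' \<in> T" using xS y' unfolding S_def by auto
    show False
    \<comment> \<open>The common sign of \<open>p\<close> at \<open>x\<close> and \<open>y'\<close>
      decides which set has the extra point: \<open>Q x\<close> contains in addition
      \<open>y'\<close>, or \<open>Q y'\<close> contains in addition \<open>x\<close>.\<close>
    proof (cases "poly p x > 0")
      case True
      then have "poly p y' > 0" using same_sign by (simp add: zero_less_mult_iff)
      then have "y' \<in> Q x" "y' \<notin> Q y'" "x \<notin> Q x" "x \<notin> Q y'"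
        using True y'(2) xT unfolding Q_def by (auto simp: zero_less_mult_iff)
      then have "t \<in> Q x \<longleftrightarrow> t \<in> insert y' (Q y')" for t using same[of t] by auto
      then have "Q x = insert y' (Q y')" by blast
      then show False using card_Q[OF xS] card_Q[OF y'(1)] \<open>y' \<notin> Q y'\<close> finQ by simp
    next
      case False
      then have "poly p x < 0" "poly p y' < 0" using same_sign nz by (auto simp: zero_less_mult_iff)
      then have "x \<in> Q y'" "x \<notin> Q x" "y' \<notin> Q x" "y' \<notin> Q y'"
        using y'(2) xT unfolding Q_def by (auto simp: zero_less_mult_iff)
      then have "t \<in> Q y' \<longleftrightarrow> t \<in> insert x (Q x)" for t using same[of t] by auto
      then have "Q y' = insert x (Q x)" by blast
      then show False using card_Q[OF xS] card_Q[OF y'(1)] \<open>x \<notin> Q x\<close> finQ by simp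
    qed
  qed
qed


section \<open>Spaces of dimension three\<close>

text \<open>For \<open>s\<close> outside \<open>A\<close>, \<open>dim_2_structure\<close> applies to
  \<open>through V s\<close> and yields a set \<open>C s\<close> of \<open>d - 1\<close> common
  zeros. Two such sets coincide or meet only in \<open>A\<close>; comparing sizes gives
  \<open>card A = d - 2\<close>, hence \<open>C s = insert s A\<close>. Varying \<open>s\<close>
  then transfers separation to \<open>A\<close>.\<close>

lemma dim_3_structure:
  assumes V: "subspace V" "dim V = 3"
    and T: "card T = d + 2 * r" "r \<ge> 2" "involution_free T"
    and K: "\<And>v. v \<in> V \<Longrightarrow> card (pos v) \<le> Suc (Suc r)"
  shows "card (common_zer V) + 2 = d"
    and "\<And>x y. x \<in> T - common_zer V \<Longrightarrow> y \<in> T - common_zer V \<Longrightarrow> x < y \<Longrightarrow>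
      \<exists>a\<in>common_zer V. x < a \<and> a < y"
proof -
  define A where "A = common_zer V"
  define S where "S = T - A"
  define C where "C s = common_zer (through V s)" for s
  have A_sub: "A \<subseteq> T" "finite A" unfolding A_def common_zer_def using finite_T by auto
  have finC: "finite (C s)" for s unfolding C_def by simp
  have dim2: "dim (through V s) = 2" if "s \<in> S" for s
    using dim_through_point[OF V(1)] that V(2) by (simp add: S_def A_def)
  have K': "card (pos v) \<le> Suc r" if "s \<in> S" "v \<in> through V s" for s v
    using card_pos_through[OF V(1) K] that unfolding S_def A_def by blast
  have sub: "subspace (through V s)" for s using V(1) by (rule subspace_through)
  have card_C: "Suc (card (C s)) = d" if "s \<in> S" for s
    unfolding C_def using dim_2_structure(1)[OF sub dim2[OF that] T K'[OF that]] .
  have sep_C: "\<exists>a\<in>C s. x < a \<and> a < y" if "s \<in> S" "x \<in> T - C s" "y \<in> T - C s" "x < y" for s x y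
    using dim_2_structure(2)[OF sub dim2[OF that(1)] T K'[OF that(1)]] that(2-4)
    unfolding C_def by blast
  have in_C: "s \<in> C s" if "s \<in> S" for s
    using that unfolding C_def common_zer_def through_def S_def by blast
  have A_C: "A \<subseteq> C s" for s
    unfolding A_def C_def common_zer_def through_def by blast
  have disj: "C s \<inter> C s' \<subseteq> A" if s: "s \<in> S" "s' \<in> S" "s' \<notin> C s" for s s'
  proof (rule ccontr)
    assume "\<not> ?thesis"
    then obtain t where t: "t \<in> C s" "t \<in> C s'" "t \<in> S"
      unfolding S_def C_def common_zer_def by blast
    \<comment> \<open>As \<open>t\<close> is outside \<open>A\<close>, both subspaces have dimension
      2, and one contains the other.\<close>
    have "through V u = through V t" if "u \<in> S" "t \<in> C u" for u
    proof (rule subspace_dim_equal)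
      show "through V u \<subseteq> through V t"
        using that unfolding C_def common_zer_def through_def by blast
      show "dim (through V t) \<le> dim (through V u)" using dim2 that t by simp
    qed (rule sub)+
    then have "C s = C s'" using s t unfolding C_def by metis
    then show False using in_C[OF s(2)] s(3) by blast
  qed
  have card_S: "card S + card A = d + 2 * r"
    using T(1) A_sub finite_T unfolding S_def
    by (metis card_Diff_subset card_mono le_add_diff_inverse2)
  have "S \<noteq> {}"
  proof
    assume "S = {}"
    then have "T = A" using A_sub unfolding S_def by blast
    moreover obtain v where "v \<in> V" "v \<noteq> 0" using exists_nonzero[of V] V(2) by auto
    ultimately have "card T \<le> card (zer v)" unfolding A_def common_zer_def zer_def
      using finite_T by (intro card_mono) auto
    then show False using card_zer_le[OF \<open>v \<noteq> 0\<close>] T by linarith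
  qed
  then obtain s where s: "s \<in> S" by blast
  obtain s' where s': "s' \<in> T" "s' \<notin> C s"
  proof -
    have "\<not> T \<subseteq> C s" using card_mono[OF finC, of T s] card_C[OF s] T(1) by linarith
    then show ?thesis using that by blast
  qed
  then have s'S: "s' \<in> S" using A_C[of s] unfolding S_def by blast
  \<comment> \<open>\<open>g\<close> has at most \<open>d\<close> zeros, while \<open>C s\<close> and \<open>C s'\<close> have \<open>d - 1\<close> elements each and share only \<open>A\<close>.\<close>
  obtain g where g: "g \<in> through (through V s) s'" "g \<noteq> 0"
  proof -
    have "s' \<in> T - common_zer (through V s)" using s' unfolding C_def by blast
    then have "dim (through (through V s) s') = 1"
      using dim_through_point[OF sub] dim2[OF s] by simp
    then show ?thesis using exists_nonzero[of "through (through V s) s'"] that by auto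
  qed
  have "C s \<union> C s' \<subseteq> zer g"
    using g(1) unfolding C_def common_zer_def through_def zer_def by blast
  then have "card (C s \<union> C s') \<le> d" using card_zer_le[OF g(2)] card_mono[OF finite_zer] by (meson order_trans)
  moreover have "card (C s \<union> C s') + card (C s \<inter> C s') = card (C s) + card (C s')"
    using card_Un_Int[OF finC finC] by simp
  moreover have "card (C s \<inter> C s') \<le> card A"
    using disj[OF s s'S s'(2)] A_sub(2) by (intro card_mono) auto
  moreover have "Suc (card A) \<le> card (C s)"
  proof -
    have "insert s A \<subseteq> C s" using in_C[OF s] A_C by blast
    then have "card (insert s A) \<le> card (C s)" by (intro card_mono finC)
    then show ?thesis using s A_sub unfolding S_def by simp
  qed
  ultimately have cA: "card A + 2 = d" using card_C[OF s] card_C[OF s'S] by linarith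
  then show "card (common_zer V) + 2 = d" unfolding A_def .
  have C_eq: "C u = insert u A" if u: "u \<in> S" for u
  proof -
    have "insert u A \<subseteq> C u" using in_C[OF u] A_C by blast
    moreover have "card (insert u A) = card (C u)"
      using card_C[OF u] cA u A_sub unfolding S_def by simp
    ultimately show ?thesis by (metis card_subset_eq finC)
  qed
  \<comment> \<open>The separating element of \<open>C u = insert u A\<close> lies in \<open>A\<close> if \<open>u\<close> is outside \<open>[x, y]\<close>.\<close>
  have sep: "\<exists>a\<in>A. x < a \<and> a < y" if "x \<in> S" "y \<in> S" "x < y" "u \<in> S" "\<not> (x \<le> u \<and> u \<le> y)" for x y u
    using sep_C[OF that(4), of x y] that unfolding C_eq[OF that(4)] S_def by fastforce
  show "\<exists>a\<in>common_zer V. x < a \<and> a < y"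
    if x: "x \<in> T - common_zer V" and y: "y \<in> T - common_zer V" and xy: "x < y" for x y
  proof -
    have xyS: "x \<in> S" "y \<in> S" using x y unfolding S_def A_def by auto
    \<comment> \<open>As \<open>card S = 2 * r + 2\<close>, there is a third point \<open>u\<close>.
      If it lies strictly between \<open>x\<close> and \<open>y\<close>, then \<open>y\<close> is
      outside the interval from \<open>x\<close> to \<open>u\<close>; otherwise \<open>u\<close> is
      outside the interval from \<open>x\<close> to \<open>y\<close>.\<close>
    have "card {x, y} < card S" using card_S cA T(2) by (simp add: card_insert_if)
    then have "\<not> S \<subseteq> {x, y}" using card_mono[of "{x, y}" S] by auto
    then obtain u where u: "u \<in> S" "u \<noteq> x" "u \<noteq> y" by blast
    show ?thesis
    proof (cases "x < u \<and> u < y")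
      case True
      then show ?thesis using sep[OF xyS(1) u(1) _ xyS(2)] unfolding A_def by force
    next
      case False
      then show ?thesis using sep[OF xyS xy u(1)] u unfolding A_def by force
    qed
  qed
qed

text \<open>Otherwise the bound is \<open>k - 1\<close>, which is \<open>r + 1\<close> for
  \<open>l = 2\<close> and \<open>r + 2\<close> for \<open>l = 3\<close> with
  \<open>r = k - l\<close>. The structure lemmas then give
  \<open>2 k - l - 1 \<le> d - l + 2\<close> by separation, so
  \<open>d \<ge> 2 k - 3\<close>.\<close>

lemma many_positive:
  assumes V: "subspace V" "dim V = l" "l \<in> {2, 3}"
    and T: "card T = d + 2 * (k - l)" "involution_free T"
    and k: "k - l \<ge> 2" "d \<le> 2 * (k - 2)"
  shows "\<exists>v\<in>V. card (pos v) \<ge> k"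
proof (rule ccontr)
  assume "\<not> ?thesis"
  then have K: "card (pos v) < k" if "v \<in> V" for v using that by force
  define A where "A = common_zer V"
  have "card A + l = Suc d \<and> (\<forall>x\<in>T - A. \<forall>y\<in>T - A. x < y \<longrightarrow> (\<exists>a\<in>A. x < a \<and> a < y))"
  proof (cases "l = 2")
    case True
    have "\<And>v. v \<in> V \<Longrightarrow> card (pos v) \<le> Suc (k - l)" using K k True by force
    then show ?thesis
      using dim_2_structure[OF V(1) _ T(1) k(1) T(2)] True V(2) unfolding A_def by auto
  next
    case False
    then have l: "l = 3" using V(3) by simp
    have "\<And>v. v \<in> V \<Longrightarrow> card (pos v) \<le> Suc (Suc (k - l))" using K k l by force
    then show ?thesis
      using dim_3_structure[OF V(1) _ T(1) k(1) T(2)] l V(2) unfolding A_def by auto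
  qed
  then have A: "card A + l = Suc d"
    and sep: "\<And>x y. x \<in> T - A \<Longrightarrow> y \<in> T - A \<Longrightarrow> x < y \<Longrightarrow> \<exists>a\<in>A. x < a \<and> a < y"
    by blast+
  have A_sub: "A \<subseteq> T" "finite A" unfolding A_def common_zer_def using finite_T by auto
  have "card (T - A) \<le> Suc (card A)"
    using finite_T A_sub sep by (intro card_le_Suc_card_if_separated) auto
  moreover have "card (T - A) = card T - card A" using A_sub by (simp add: card_Diff_subset)
  ultimately show False using A T(1) k V(3) by auto
qed

end

section \<open>The moment curve\<close>

text \<open>With \<open>idx\<close> numbering the coordinates by 0, ..., d - 1, the exponents are 1,
  ..., d. The constant term enters through the base point \<open>x0\<close> of
  \<open>moment_poly\<close>.\<close>

definition moment_curve :: "('n \<Rightarrow> nat) \<Rightarrow> real \<Rightarrow> real ^ 'n::finite" where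
  "moment_curve idx t = (\<chi> i. t ^ Suc (idx i))"

definition moment_poly :: "('n \<Rightarrow> nat) \<Rightarrow> real ^ 'n::finite \<Rightarrow> real ^ 'n \<Rightarrow> real poly" where
  "moment_poly idx x0 c = (\<Sum>i\<in>UNIV. monom (c $ i) (Suc (idx i))) - [:c \<bullet> x0:]"

lemma poly_moment_poly: "poly (moment_poly idx x0 c) t = c \<bullet> moment_curve idx t - c \<bullet> x0"
  unfolding moment_poly_def moment_curve_def
  by (simp add: poly_sum poly_monom inner_vec_def)

lemma coeff_moment_poly:
  assumes "inj idx"
  shows "coeff (moment_poly idx x0 c) (Suc (idx j)) = c $ j"
proof -
  have "coeff (moment_poly idx x0 c) (Suc (idx j)) = (\<Sum>i\<in>UNIV. if i = j then c $ i else 0)"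
    unfolding moment_poly_def using assms
    by (auto simp: coeff_sum inj_eq intro!: sum.cong)
  then show ?thesis by simp
qed

lemma poly_coordinates_moment_poly:
  assumes idx: "bij_betw idx (UNIV :: 'n::finite set) {0..<CARD('n)}" and "finite T"
  shows "poly_coordinates (moment_poly idx (x0 :: real ^ 'n)) CARD('n) T"
proof
  have inj: "inj idx" using idx by (rule bij_betw_imp_inj_on)
  show "moment_poly idx x0 (u + v) = moment_poly idx x0 u + moment_poly idx x0 v" for u v
    by (simp add: poly_eq_poly_eq_iff[symmetric] fun_eq_iff poly_moment_poly inner_add_left)
  show "moment_poly idx x0 (c *\<^sub>R v) = smult c (moment_poly idx x0 v)" for c v
    by (simp add: poly_eq_poly_eq_iff[symmetric] fun_eq_iff poly_moment_poly right_diff_distrib)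
  show "v = 0" if "moment_poly idx x0 v = 0" for v
    using coeff_moment_poly[OF inj, of x0 v] that by (simp add: vec_eq_iff)
  show "degree (moment_poly idx x0 v) \<le> CARD('n)" for v
  proof -
    have "Suc (idx i) \<le> CARD('n)" for i
      using idx by (metis Suc_leI UNIV_I atLeastLessThan_iff bij_betw_apply)
    then show ?thesis
      unfolding moment_poly_def
      by (intro degree_diff_le degree_sum_le order_trans[OF degree_monom_le]) auto
  qed
qed (fact assms(2))

lemma inj_moment_curve:
  assumes idx: "bij_betw idx (UNIV :: 'n::finite set) {0..<CARD('n)}"
  shows "inj (moment_curve idx :: real \<Rightarrow> real ^ 'n)"
proof (rule injI)
  fix s t assume eq: "moment_curve idx s = (moment_curve idx t :: real ^ 'n)"
  have "0 \<in> idx ` UNIV" using idx unfolding bij_betw_def by simp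
  then obtain i where "idx i = 0" by force
  then show "s = t" using arg_cong[OF eq, of "\<lambda>v. v $ i"] by (simp add: moment_curve_def)
qed

text \<open>Elements of the orthogonal complement \<open>V\<close> of the direction space of
  \<open>L\<close> are constant on \<open>L\<close>. One with \<open>k\<close> positive points
  places the hull of the corresponding curve points in an open half-space that misses
  \<open>L\<close>.\<close>

lemma no_kneser_transversal:
  fixes X :: "(real ^ 'n::finite) set"
  assumes idx: "bij_betw idx (UNIV :: 'n set) {0..<CARD('n)}"
    and T: "finite T" "involution_free T" "card T \<ge> CARD('n) + 2 * (k - l)"
    and l: "l \<in> {2, 3}" "k - l \<ge> 2" "l \<le> CARD('n)" "CARD('n) \<le> 2 * (k - 2)"
  shows "\<not> kneser_transversal k l (moment_curve idx ` T) (L :: (real ^ 'n) set)"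
proof
  assume L: "kneser_transversal k l (moment_curve idx ` T) L"
  \<comment> \<open>The count in \<open>many_positive\<close> needs exactly this many points; the
    transversal also serves every subset.\<close>
  obtain T' where T': "T' \<subseteq> T" "card T' = CARD('n) + 2 * (k - l)" "finite T'"
    using obtain_subset_with_card_n[OF T(3)] by blast
  have affL: "affine L" "aff_dim L = int CARD('n) - int l"
    using L unfolding kneser_transversal_def by auto
  then have "L \<noteq> {}" using l(3) by auto
  then obtain x0 where x0: "x0 \<in> L" by blast
  define D where "D = (\<lambda>x. x - x0) ` L"
  have D: "subspace D" unfolding D_def
    using affine_diffs_subspace_subtract[OF affL(1) x0] by simp
  have dimD: "int (dim D) = int CARD('n) - int l"
    using aff_dim_dim_affine_diffs[OF affL(1) x0] affL(2) unfolding D_def by simp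
  define V where "V = {c. \<forall>y\<in>D. orthogonal y c}"
  have V: "subspace V" unfolding V_def by (rule subspace_orthogonal_to_vectors)
  have dimV: "dim V = l"
    using dim_subspace_orthogonal_to_vectors[OF D subspace_UNIV] dimD l(3) unfolding V_def by simp
  interpret poly_coordinates "moment_poly idx x0" "CARD('n)" T'
    by (rule poly_coordinates_moment_poly[OF idx T'(3)])
  obtain c where c: "c \<in> V" "card (pos c) \<ge> k"
    using many_positive[OF V dimV l(1) T'(2) involution_free_subset[OF T(2) T'(1)] l(2,4)] by blast
  obtain Y where Y: "Y \<subseteq> pos c" "card Y = k" using obtain_subset_with_card_n[OF c(2)] by blast
  have "card (moment_curve idx ` Y :: (real ^ 'n) set) = k"
    using Y(2) inj_on_subset[OF inj_moment_curve[OF idx]] by (subst card_image) auto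
  moreover have "Y \<subseteq> T" using Y(1) T'(1) unfolding pos_def by blast
  ultimately obtain x where x: "x \<in> L" "x \<in> convex hull (moment_curve idx ` Y)"
    using L unfolding kneser_transversal_def by blast
  have "moment_curve idx ` Y \<subseteq> {y. c \<bullet> y > c \<bullet> x0}"
    using Y(1) unfolding pos_def poly_moment_poly by auto
  then have "convex hull (moment_curve idx ` Y) \<subseteq> {y. c \<bullet> y > c \<bullet> x0}"
    by (rule hull_minimal) (rule convex_halfspace_gt)
  then have "c \<bullet> x > c \<bullet> x0" using x(2) by blast
  moreover have "(x - x0) \<bullet> c = 0" using c(1) x(1) unfolding V_def D_def orthogonal_def by blast
  ultimately show False by (simp add: inner_diff_left inner_commute[of c])
qed

section \<open>The maximum defining \<open>kneser_m\<close>\<close>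

lemma kneser_transversal_vacuous:
  assumes "finite X" "card X < k" "l \<le> CARD('n)"
  shows "\<exists>L. kneser_transversal k l (X :: (real ^ 'n::finite) set) L"
proof -
  obtain L :: "(real ^ 'n) set" where L: "subspace L" "dim L = CARD('n) - l"
    using choose_subspace_of_subspace[of "CARD('n) - l" "UNIV :: (real ^ 'n) set"] by auto
  have "\<not> (Y \<subseteq> X \<and> card Y = k)" for Y using assms card_mono by (metis not_le)
  then have "kneser_transversal k l X L"
    unfolding kneser_transversal_def
    using L assms(3) by (auto simp: subspace_imp_affine aff_dim_subspace)
  then show ?thesis by blast
qed

theorem theorem3p1:
  fixes k d l :: nat
  assumes "l \<in> {2, 3}"
    and "d = CARD('n::finite)"
    and "k - l \<ge> 2"
    and "2 * (l - 1) \<le> d"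
    and "d \<le> 2 * (k - 2)"
  shows "kneser_m k TYPE('n) l < d + 2 * (k - l)"
proof -
  define N where "N = {n. n \<ge> 1 \<and>
    (\<forall>X :: (real ^ 'n) set. finite X \<and> card X = n \<longrightarrow> (\<exists>L. kneser_transversal k l X L))}"
  \<comment> \<open>Since \<open>l \<ge> 2\<close>, one has
    \<open>l \<le> 2 * (l - 1) \<le> d\<close>.\<close>
  have ld: "l \<le> CARD('n)" using assms by auto
  \<comment> \<open>Excluding every \<open>n\<close> from \<open>d + 2 * (k - l)\<close> on, not
    just that value, makes \<open>N\<close> finite, so that \<open>Max N\<close> is a member of
    \<open>N\<close>.\<close>
  have bound: "n < d + 2 * (k - l)" if "n \<in> N" for n
  proof (rule ccontr)
    assume "\<not> ?thesis"
    then have n: "n \<ge> CARD('n) + 2 * (k - l)" using assms(2) by simp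
    obtain T where T: "finite T" "card T = n" "involution_free T"
      using involution_free_exists by blast
    obtain idx :: "'n \<Rightarrow> nat" where idx: "bij_betw idx UNIV {0..<CARD('n)}"
      using ex_bij_betw_finite_nat[OF finite[of UNIV]] by blast
    have "card (moment_curve idx ` T :: (real ^ 'n) set) = n"
      using T(2) inj_on_subset[OF inj_moment_curve[OF idx]] by (subst card_image) auto
    then obtain L :: "(real ^ 'n) set" where "kneser_transversal k l (moment_curve idx ` T) L"
      using \<open>n \<in> N\<close> T(1) unfolding N_def by blast
    then show False
      using no_kneser_transversal[OF idx T(1,3), of k l L] T(2) n ld assms by simp
  qed
  have "1 \<in> N"
    unfolding N_def using kneser_transversal_vacuous[OF _ _ ld, of _ k] assms(3) by auto
  moreover have "finite N" using bound by (intro finite_subset[of N "{..<d + 2 * (k - l)}"]) auto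
  ultimately have "Max N \<in> N" by (intro Max_in) auto
  then show ?thesis using bound unfolding kneser_m_def N_def by blast
qed

end
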